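(* Let $F$ be a nullnorm, let $\circ$ be a binary operation on a set $M$, and let $E$ be an $F$-indistinguishability operator on $M$ that is regular with respect to $\circ$. Define $\tilde{\circ}:M\times M\times M\to[0,1]$ by $\tilde{\circ}(x,y,z)=E(x\circ y,z)$ for all $x,y,z\in M$. Then: (1) $\tilde{\circ}$ is an $F$-vague binary operation on $M$ (with respect to $E$). (2) If $(M,\circ)$ is a monoid, then $(M,\tilde{\circ})$ is an $F$-vague monoid.
   Context: A nullnorm is a map $F:[0,1]^2\to[0,1]$ that is commutative, associative, non-decreasing in each argument, and for which there is $k\in[0,1]$ with $F(k,x)=k$ for all $x\in[0,1]$, $F(0,x)=x$ for all $x\le k$, and $F(1,x)=x$ for all $x\ge k$. By associativity, $F(a,b,c,d)$ denotes the iterated value $F(F(F(a,b),c),d)$. An $F$-indistinguishability operator on $M$ is a map $E:M\times M\to[0,1]$ with $E(x,x)=1$, $E(x,y)=E(y,x)$ and $F(E(x,y),E(y,z))\le E(x,z)$ for all $x,y,z\in M$. $E$ is regular with respect to $\circ$ if $E(x,y)\le E(x\circ z,y\circ z)$ and $E(x,y)\le E(z\circ x,z\circ y)$ for all $x,y,z\in M$. An $F$-vague binary operation on $M$ (with respect to $E$) is a map $\tilde{\circ}:M^3\to[0,1]$ such that for all $x,y,z,x',y',z'\in M$: (i) $F(\tilde{\circ}(x,y,z),E(x,x'),E(y,y'),E(z,z'))\le\tilde{\circ}(x',y',z')$; (ii) $F(\tilde{\circ}(x,y,z),\tilde{\circ}(x,y,z'))\le E(z,z')$; (iii) for all $x,y\in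 M$ there is $z\in M$ with $\tilde{\circ}(x,y,z)=1$. $(M,\tilde{\circ})$ is an $F$-vague monoid if $\tilde{\circ}$ is an $F$-vague binary operation with respect to $E$, $F(\tilde{\circ}(y,z,d),\tilde{\circ}(x,d,m),\tilde{\circ}(x,y,q),\tilde{\circ}(q,z,w))\le E(m,w)$ for all $x,y,z,d,m,q,w\in M$, and there is $e\in M$ with $\tilde{\circ}(e,x,x)=1=\tilde{\circ}(x,e,x)$ for all $x\in M$. *)

theory Defs
  imports Complex_Main "HOL-Library.FuncSet" "HOL-Algebra.Group"
begin

text \<open>
  Maps on \<open>[0,1]\<close> or on a set \<open>M\<close> are total curried functions. Each predicate below constrains
  their values only on arguments from \<open>{0..1}\<close> or \<open>M\<close>.
\<close>

definition nullnorm :: "(real \<Rightarrow> real \<Rightarrow> real) \<Rightarrow> bool" where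
  "nullnorm F \<longleftrightarrow>
     F \<in> {0..1} \<rightarrow> {0..1} \<rightarrow> {0..1} \<and>
     (\<forall>a\<in>{0..1}. \<forall>b\<in>{0..1}. F a b = F b a) \<and>
     (\<forall>a\<in>{0..1}. \<forall>b\<in>{0..1}. \<forall>c\<in>{0..1}. F (F a b) c = F a (F b c)) \<and>
     (\<forall>a\<in>{0..1}. mono_on {0..1} (\<lambda>b. F a b)) \<and>
     (\<forall>b\<in>{0..1}. mono_on {0..1} (\<lambda>a. F a b)) \<and>
     (\<exists>k\<in>{0..1}. (\<forall>x\<in>{0..1}. F k x = k) \<and>
                 (\<forall>x\<in>{0..1}. x \<le> k \<longrightarrow> F 0 x = x) \<and>
                 (\<forall>x\<in>{0..1}. k \<le> x \<longrightarrow> F 1 x = x))"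

definition iter4 :: "(real \<Rightarrow> real \<Rightarrow> real) \<Rightarrow> real \<Rightarrow> real \<Rightarrow> real \<Rightarrow> real \<Rightarrow> real" where
  "iter4 F a b c d = F (F (F a b) c) d"

definition indistinguishability ::
    "(real \<Rightarrow> real \<Rightarrow> real) \<Rightarrow> 'a set \<Rightarrow> ('a \<Rightarrow> 'a \<Rightarrow> real) \<Rightarrow> bool" where
  "indistinguishability F M E \<longleftrightarrow>
     E \<in> M \<rightarrow> M \<rightarrow> {0..1} \<and>
     (\<forall>x\<in>M. E x x = 1) \<and>
     (\<forall>x\<in>M. \<forall>y\<in>M. E x y = E y x) \<and>
     (\<forall>x\<in>M. \<forall>y\<in>M. \<forall>z\<in>M. F (E x y) (E y z) \<le> E x z)"

definition regular :: "'a set \<Rightarrow> ('a \<Rightarrow> 'a \<Rightarrow> 'a) \<Rightarrow> ('a \<Rightarrow> 'a \<Rightarrow> real) \<Rightarrow> bool" where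
  "regular M f E \<longleftrightarrow>
     (\<forall>x\<in>M. \<forall>y\<in>M. \<forall>z\<in>M. E x y \<le> E (f x z) (f y z) \<and> E x y \<le> E (f z x) (f z y))"

definition vague_binary_operation ::
    "(real \<Rightarrow> real \<Rightarrow> real) \<Rightarrow> 'a set \<Rightarrow> ('a \<Rightarrow> 'a \<Rightarrow> real) \<Rightarrow> ('a \<Rightarrow> 'a \<Rightarrow> 'a \<Rightarrow> real) \<Rightarrow> bool"
  where
  "vague_binary_operation F M E V \<longleftrightarrow>
     V \<in> M \<rightarrow> M \<rightarrow> M \<rightarrow> {0..1} \<and>
     (\<forall>x\<in>M. \<forall>y\<in>M. \<forall>z\<in>M. \<forall>x'\<in>M. \<forall>y'\<in>M. \<forall>z'\<in>M.
        iter4 F (V x y z) (E x x') (E y y') (E z z') \<le> V x' y' z') \<and>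
     (\<forall>x\<in>M. \<forall>y\<in>M. \<forall>z\<in>M. \<forall>z'\<in>M. F (V x y z) (V x y z') \<le> E z z') \<and>
     (\<forall>x\<in>M. \<forall>y\<in>M. \<exists>z\<in>M. V x y z = 1)"

definition vague_monoid ::
    "(real \<Rightarrow> real \<Rightarrow> real) \<Rightarrow> 'a set \<Rightarrow> ('a \<Rightarrow> 'a \<Rightarrow> real) \<Rightarrow> ('a \<Rightarrow> 'a \<Rightarrow> 'a \<Rightarrow> real) \<Rightarrow> bool"
  where
  "vague_monoid F M E V \<longleftrightarrow>
     vague_binary_operation F M E V \<and>
     (\<forall>x\<in>M. \<forall>y\<in>M. \<forall>z\<in>M. \<forall>d\<in>M. \<forall>m\<in>M. \<forall>q\<in>M. \<forall>w\<in>M.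
        iter4 F (V y z d) (V x d m) (V x y q) (V q z w) \<le> E m w) \<and>
     (\<exists>e\<in>M. \<forall>x\<in>M. V e x x = 1 \<and> V x e x = 1)"

text \<open>\<open>(M, f)\<close> carries no distinguished identity, so the one of the library's monoid record is
  quantified existentially.\<close>

definition is_monoid :: "'a set \<Rightarrow> ('a \<Rightarrow> 'a \<Rightarrow> 'a) \<Rightarrow> bool" where
  "is_monoid M f \<longleftrightarrow> (\<exists>e. Group.monoid \<lparr>carrier = M, mult = f, one = e\<rparr>)"

end

theory Submission
  imports Defs
begin

text \<open>
  If \<open>p \<le> E u v\<close> and \<open>q \<le> E v w\<close>, then monotonicity and \<open>F\<close>-transitivity give
  \<open>F p q \<le> E u w\<close>. Every inequality to be shown is a chain of such steps from point to point, with
  regularity turning \<open>E x x'\<close> into a bound for a step between two products.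
\<close>

lemma transitive_step:
  assumes F: "nullnorm F" and E: "indistinguishability F M E"
    and "u \<in> M" "v \<in> M" "w \<in> M"
    and p: "p \<in> {0..E u v}" and q: "q \<in> {0..E v w}"
  shows "F p q \<in> {0..E u w}"
proof -
  have uv: "E u v \<in> {0..1}" and vw: "E v w \<in> {0..1}" and trans: "F (E u v) (E v w) \<le> E u w"
    using E assms(3-5) unfolding indistinguishability_def by blast+
  \<comment> \<open>The lower end 0 of the intervals is needed here: \<open>nullnorm\<close>
    constrains \<open>F\<close> only on arguments from [0,1].\<close>
  then have p1: "p \<in> {0..1}" and q1: "q \<in> {0..1}"
    using p q by auto
  have mono: "mono_on {0..1} (\<lambda>a. F a q)" "mono_on {0..1} (F (E u v))"
    using F q1 uv unfolding nullnorm_def by blast+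
  have "F p q \<le> F (E u v) q"
    using mono_onD[OF mono(1) p1 uv] p by simp
  also have "\<dots> \<le> F (E u v) (E v w)"
    using mono_onD[OF mono(2) q1 vw] q by simp
  finally have "F p q \<le> E u w"
    using trans by simp
  \<comment> \<open>Closure of [0,1] under \<open>F\<close> supplies the lower bound 0, so the
    result can serve as the \<open>p\<close> of a further step.\<close>
  moreover have "F p q \<in> {0..1}"
    using F p1 q1 unfolding nullnorm_def by blast
  ultimately show ?thesis
    by simp
qed

theorem proposition4p15:
  fixes F :: "real \<Rightarrow> real \<Rightarrow> real"
    and M :: "'a set"
    and f :: "'a \<Rightarrow> 'a \<Rightarrow> 'a"
    and E :: "'a \<Rightarrow> 'a \<Rightarrow> real"
    and V :: "'a \<Rightarrow> 'a \<Rightarrow> 'a \<Rightarrow> real"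
  assumes "nullnorm F"
    and "f \<in> M \<rightarrow> M \<rightarrow> M"
    and "indistinguishability F M E"
    and "regular M f E"
    and "\<And>x y z. x \<in> M \<Longrightarrow> y \<in> M \<Longrightarrow> z \<in> M \<Longrightarrow> V x y z = E (f x y) z"
  shows "vague_binary_operation F M E V \<and>
         (is_monoid M f \<longrightarrow> vague_monoid F M E V)"
proof -
  note F = assms(1) and E = assms(3) and V = assms(5)
  have fM: "f x y \<in> M" if "x \<in> M" "y \<in> M" for x y
    using assms(2) that by blast
  have "E \<in> M \<rightarrow> M \<rightarrow> {0..1}"
    using E unfolding indistinguishability_def by blast
  then have range: "0 \<le> E x y" "E x y \<le> 1" if "x \<in> M" "y \<in> M" for x y
    using that by fastforce+
  have refl: "E x x = 1" if "x \<in> M" for x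
    using E that unfolding indistinguishability_def by blast
  have sym: "E x y = E y x" if "x \<in> M" "y \<in> M" for x y
    using E that unfolding indistinguishability_def by blast
  have left: "E x y \<le> E (f x z) (f y z)" and right: "E x y \<le> E (f z x) (f z y)"
    if "x \<in> M" "y \<in> M" "z \<in> M" for x y z
    using assms(4) that unfolding regular_def by blast+
  \<comment> \<open>For steps that need no regularity, the value of \<open>E\<close> serves as its
    own bound.\<close>
  have step: "E x y \<in> {0..E x y}" if "x \<in> M" "y \<in> M" for x y
    using range that by simp
  have vague: "vague_binary_operation F M E V"
    unfolding vague_binary_operation_def
  proof (intro conjI ballI)
    show "V \<in> M \<rightarrow> M \<rightarrow> M \<rightarrow> {0..1}"
      using V fM range by auto
  next
    fix x y z x' y' z'
    assume M: "x \<in> M" "y \<in> M" "z \<in> M" "x' \<in> M" "y' \<in> M" "z' \<in> M"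
    let ?xy = "f x y" and ?x'y = "f x' y" and ?x'y' = "f x' y'"
    note prods = fM[OF M(1,2)] fM[OF M(4,2)] fM[OF M(4,5)]
    \<comment> \<open>The path starts at \<open>z\<close> and goes to \<open>?xy\<close>,
      \<open>?x'y\<close> and \<open>?x'y'\<close>, changing one factor of the product at a time.
      Its first step is \<open>E ?xy z\<close> read backwards, which symmetry permits.\<close>
    have steps: "E ?xy z \<in> {0..E z ?xy}" "E x x' \<in> {0..E ?xy ?x'y}" "E y y' \<in> {0..E ?x'y ?x'y'}"
      using M prods by (simp_all add: range sym left right)
    have "F (E ?xy z) (E x x') \<in> {0..E z ?x'y}"
      by (rule transitive_step[OF F E M(3) prods(1,2) steps(1,2)])
    then have "F (F (E ?xy z) (E x x')) (E y y') \<in> {0..E z ?x'y'}"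
      by (rule transitive_step[OF F E M(3) prods(2,3) _ steps(3)])
    \<comment> \<open>The last factor \<open>E z z'\<close> starts at \<open>z\<close>, so the path
      built so far is reversed to end there.\<close>
    then have "F (F (E ?xy z) (E x x')) (E y y') \<in> {0..E ?x'y' z}"
      using M prods by (simp add: sym)
    then have "F (F (F (E ?xy z) (E x x')) (E y y')) (E z z') \<in> {0..E ?x'y' z'}"
      by (rule transitive_step[OF F E prods(3) M(3,6) _ step[OF M(3,6)]])
    then show "iter4 F (V x y z) (E x x') (E y y') (E z z') \<le> V x' y' z'"
      using M by (simp add: V iter4_def)
  next
    fix x y z z'
    assume M: "x \<in> M" "y \<in> M" "z \<in> M" "z' \<in> M"
    \<comment> \<open>The path is \<open>z\<close>, \<open>f x y\<close>, \<open>z'\<close>.\<close>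
    then have "E (f x y) z \<in> {0..E z (f x y)}"
      by (simp add: range sym fM)
    then have "F (E (f x y) z) (E (f x y) z') \<in> {0..E z z'}"
      by (rule transitive_step[OF F E M(3) fM[OF M(1,2)] M(4) _ step[OF fM[OF M(1,2)] M(4)]])
    then show "F (V x y z) (V x y z') \<le> E z z'"
      using M by (simp add: V)
  next
    fix x y
    assume "x \<in> M" "y \<in> M"
    then show "\<exists>z\<in>M. V x y z = 1"
      by (auto simp: V fM refl intro: bexI[of _ "f x y"])
  qed
  moreover have "vague_monoid F M E V" if "is_monoid M f"
  proof -
    obtain e where "Group.monoid \<lparr>carrier = M, mult = f, one = e\<rparr>"
      using \<open>is_monoid M f\<close> unfolding is_monoid_def by blast
    then interpret Group.monoid "\<lparr>carrier = M, mult = f, one = e\<rparr>" .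
    have assoc: "f (f x y) z = f x (f y z)" if "x \<in> M" "y \<in> M" "z \<in> M" for x y z
      using m_assoc that by simp
    have unit: "f e x = x" "f x e = x" if "x \<in> M" for x
      using l_one r_one that by simp_all
    show ?thesis
      unfolding vague_monoid_def
    proof (intro conjI ballI)
      fix x y z d m q w
      assume M: "x \<in> M" "y \<in> M" "z \<in> M" "d \<in> M" "m \<in> M" "q \<in> M" "w \<in> M"
      let ?xyz = "f x (f y z)"
      have prods: "f y z \<in> M" "f x d \<in> M" "f x y \<in> M" "f q z \<in> M" "?xyz \<in> M"
        using M fM by simp_all
      \<comment> \<open>The first two factors lead from \<open>?xyz\<close> through
        \<open>f x d\<close> to \<open>m\<close>; multiplying by \<open>x\<close> on the left yields
        the first step.\<close>
      have "E (f y z) d \<in> {0..E ?xyz (f x d)}"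
        using M prods by (simp add: range right)
      then have "F (E (f y z) d) (E (f x d) m) \<in> {0..E ?xyz m}"
        by (rule transitive_step[OF F E prods(5,2) M(5) _ step[OF prods(2) M(5)]])
      \<comment> \<open>The other two factors lead from \<open>?xyz\<close> through
        \<open>f q z\<close> to \<open>w\<close>. Reversing the first half makes the halves meet at
        \<open>?xyz\<close>.\<close>
      then have "F (E (f y z) d) (E (f x d) m) \<in> {0..E m ?xyz}"
        using M prods by (simp add: sym)
      \<comment> \<open>Multiplying by \<open>z\<close> on the right gives a step from
        \<open>f (f x y) z\<close>; associativity of \<open>f\<close> identifies this point with
        \<open>?xyz\<close>.\<close>
      moreover have "E (f x y) q \<in> {0..E ?xyz (f q z)}"
        using M prods left[of "f x y" q z] by (simp add: range assoc)
      ultimately have "F (F (E (f y z) d) (E (f x d) m)) (E (f x y) q) \<in> {0..E m (f q z)}"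
        by (rule transitive_step[OF F E M(5) prods(5,4)])
      then have "F (F (F (E (f y z) d) (E (f x d) m)) (E (f x y) q)) (E (f q z) w) \<in> {0..E m w}"
        by (rule transitive_step[OF F E M(5) prods(4) M(7) _ step[OF prods(4) M(7)]])
      then show "iter4 F (V y z d) (V x d m) (V x y q) (V q z w) \<le> E m w"
        using M by (simp add: V iter4_def)
    next
      have "e \<in> M"
        using one_closed by simp
      then show "\<exists>e\<in>M. \<forall>x\<in>M. V e x x = 1 \<and> V x e x = 1"
        by (auto simp: V unit refl intro!: bexI[of _ e])
    qed (fact vague)
  qed
  ultimately show ?thesis
    by blast
qed

end
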